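(* Let $n$ and $k$ be integers such that $n \geq 3$ and $\lceil n/3 \rceil < k < n$. Then (i) $\mathcal{D}_k(P_n)$ is Eulerian if and only if $n=4$ and $k=3$; and (ii) $\mathcal{D}_k(C_n)$ is Eulerian if and only if either $n=7$ and $k=4$, or $n=3$ and $k=2$.
   Context: All graphs are finite and simple. $P_n$ and $C_n$ denote the path and the cycle on $n$ vertices, respectively. A dominating set of a graph $G$ is a set $D \subseteq V(G)$ such that every vertex of $V(G)\setminus D$ is adjacent to a vertex of $D$. The $k$-dominating graph $\mathcal{D}_k(G)$ is the graph whose vertices are the dominating sets of $G$ of cardinality at most $k$, two of them being adjacent if and only if one can be obtained from the other by adding or removing a single vertex of $G$. A graph is Eulerian if and only if every vertex has even degree and it contains at most one non-trivial component (a graph or component is trivial if it contains no edges); in particular, an Eulerian graph may have isolated vertices. *)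

theory Defs
  imports Complex_Main
begin

text \<open>
  Undirected graphs are given by a vertex set and a set of edges, an edge being the set of its
  two ends.
\<close>

record 'a graph =
  verts :: "'a set"
  edges :: "'a set set"

definition simple_graph :: "'a graph \<Rightarrow> bool" where
  "simple_graph G \<longleftrightarrow> finite (verts G) \<and> (\<forall>e\<in>edges G. e \<subseteq> verts G \<and> card e = 2)"

definition adjacent :: "'a graph \<Rightarrow> 'a \<Rightarrow> 'a \<Rightarrow> bool" where
  "adjacent G u v \<longleftrightarrow> {u, v} \<in> edges G"

definition degree :: "'a graph \<Rightarrow> 'a \<Rightarrow> nat" where
  "degree G v = card {w \<in> verts G. adjacent G v w}"

definition connection :: "'a graph \<Rightarrow> ('a \<times> 'a) set" where
  "connection G =
     {(u, v). u \<in> verts G \<and> v \<in> verts G \<and> (adjacent G)\<^sup>*\<^sup>* u v}"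

text \<open>Components are represented by their vertex sets.\<close>

definition components :: "'a graph \<Rightarrow> 'a set set" where
  "components G = verts G // connection G"

definition nontrivial_component :: "'a graph \<Rightarrow> 'a set \<Rightarrow> bool" where
  "nontrivial_component G C \<longleftrightarrow> C \<in> components G \<and> (\<exists>e\<in>edges G. e \<subseteq> C)"

definition eulerian :: "'a graph \<Rightarrow> bool" where
  "eulerian G \<longleftrightarrow>
     (\<forall>v\<in>verts G. even (degree G v)) \<and>
     (\<forall>C C'. nontrivial_component G C \<longrightarrow> nontrivial_component G C' \<longrightarrow> C = C')"

definition path_graph :: "nat \<Rightarrow> nat graph" where
  "path_graph n = \<lparr> verts = {..<n}, edges = {{i, i + 1} | i. i + 1 < n} \<rparr>"

text \<open>The following is a simple graph, namely the cycle of length \<open>n\<close>, only for \<open>n \<ge> 3\<close>.\<close>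

definition cycle_graph :: "nat \<Rightarrow> nat graph" where
  "cycle_graph n = \<lparr> verts = {..<n}, edges = {{i, (i + 1) mod n} | i. i < n} \<rparr>"

definition dominating_set :: "'a graph \<Rightarrow> 'a set \<Rightarrow> bool" where
  "dominating_set G D \<longleftrightarrow>
     D \<subseteq> verts G \<and> (\<forall>v\<in>verts G - D. \<exists>u\<in>D. adjacent G v u)"

definition dominating_graph :: "nat \<Rightarrow> 'a graph \<Rightarrow> 'a set graph" where
  "dominating_graph k G =
     (let V = {D. dominating_set G D \<and> card D \<le> k}
      in \<lparr> verts = V,
           edges = {{A, B} | A B. A \<in> V \<and> B \<in> V \<and>
             ((\<exists>x\<in>verts G - A. B = insert x A) \<or> (\<exists>x\<in>A. B = A - {x}))} \<rparr>)"

lemma simple_graph_path_graph: "simple_graph (path_graph n)"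
  by (auto simp: simple_graph_def path_graph_def)

lemma simple_graph_cycle_graph:
  assumes "n \<ge> 3"
  shows "simple_graph (cycle_graph n)"
proof -
  have "i \<noteq> (i + 1) mod n" if "i < n" for i
    using that assms by (cases "i + 1 = n") auto
  then show ?thesis
    using assms by (auto simp: simple_graph_def cycle_graph_def card_insert_if)
qed

lemma simple_graph_dominating_graph:
  assumes "simple_graph G"
  shows "simple_graph (dominating_graph k G)"
proof -
  have "finite {D. dominating_set G D \<and> card D \<le> k}"
    by (rule finite_subset[of _ "Pow (verts G)"])
      (use assms in \<open>auto simp: simple_graph_def dominating_set_def\<close>)
  moreover have "card {A, insert x A} = 2" if "x \<notin> A" for x and A :: "'a set"
    using that by (auto simp: card_insert_if)
  moreover have "card {A, A - {x}} = 2" if "x \<in> A" for x and A :: "'a set"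
    using that by (auto simp: card_insert_if)
  ultimately show ?thesis
    by (auto simp: simple_graph_def dominating_graph_def Let_def)
qed

lemma equiv_connection: "equiv (verts G) (connection G)"
proof (rule equivI)
  have "symp (adjacent G)"
    by (auto simp: symp_def adjacent_def insert_commute)
  then have "symp (adjacent G)\<^sup>*\<^sup>*"
    by (rule symp_rtranclp)
  then show "sym (connection G)"
    by (auto simp: sym_def symp_def connection_def)
qed (auto simp: connection_def refl_on_def trans_def)

end

theory Submission
  imports Defs
begin

text \<open>
  A dominating set \<open>D\<close> with \<open>r\<close> superfluous vertices has degree \<open>n - card D + r\<close> in
  \<open>dominating_graph k G\<close> if \<open>card D < k\<close>, and degree \<open>r\<close> if \<open>card D = k\<close>. An independent dominating
  set has \<open>r = 0\<close>, so all those with fewer than \<open>k\<close> elements must have size congruent to \<open>n\<close> modulo 2.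
  For paths and cycles with \<open>n = 3 m + 2\<close> this fails for a minimum one. Otherwise, outside a few small
  cases, a minimum independent dominating set \<open>I\<close> can be replaced by two dominating sets with one
  element more: one is independent, the other has exactly one superfluous vertex. One of these sets
  or \<open>I\<close> itself has odd degree. The small cases are settled by enumeration.
\<close>

section \<open>Degrees in the dominating graph and parity obstructions\<close>

lemma verts_dominating_graph:
  "verts (dominating_graph k G) = {D. dominating_set G D \<and> card D \<le> k}"
  by (simp add: dominating_graph_def Let_def)

lemma dominating_set_mono:
  assumes "dominating_set G A" "A \<subseteq> B" "B \<subseteq> verts G"
  shows "dominating_set G B"
  using assms unfolding dominating_set_def by blast

lemma finite_dominating_set:
  assumes "simple_graph G" "dominating_set G D"
  shows "finite D"
  using assms finite_subset by (auto simp: simple_graph_def dominating_set_def)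

text \<open>Orients an edge from its smaller end, so that removals need no separate treatment
  later.\<close>

lemma edges_dominating_graphE:
  assumes "e \<in> edges (dominating_graph k G)"
  obtains A x where "e = {A, insert x A}" "x \<in> verts G - A"
    "A \<in> verts (dominating_graph k G)" "insert x A \<in> verts (dominating_graph k G)"
proof -
  obtain A B where AB: "e = {A, B}" "A \<in> verts (dominating_graph k G)"
      "B \<in> verts (dominating_graph k G)"
      "(\<exists>x\<in>verts G - A. B = insert x A) \<or> (\<exists>x\<in>A. B = A - {x})"
    using assms unfolding dominating_graph_def Let_def by simp blast
  from AB(4) show ?thesis
  proof (elim disjE bexE)
    fix x
    assume x: "x \<in> A" "B = A - {x}"
    then have "e = {B, insert x B}" "insert x B = A"
      using AB(1) by auto
    moreover have "x \<in> verts G - B"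
      using x AB(2) by (auto simp: verts_dominating_graph dominating_set_def)
    ultimately show ?thesis
      using that[of B x] AB(2,3) by simp
  qed (use AB that in simp)
qed

lemma adjacent_dominating_graph:
  assumes A: "A \<in> verts (dominating_graph k G)" and B: "B \<in> verts (dominating_graph k G)"
  shows "adjacent (dominating_graph k G) A B \<longleftrightarrow>
    (\<exists>x\<in>verts G - A. B = insert x A) \<or> (\<exists>x\<in>A. B = A - {x})"
proof
  assume "adjacent (dominating_graph k G) A B"
  then have "{A, B} \<in> edges (dominating_graph k G)"
    by (simp add: adjacent_def)
  then obtain C x where C: "{A, B} = {C, insert x C}" "x \<in> verts G - C"
    by (rule edges_dominating_graphE)
  then have "A = C \<and> B = insert x C \<or> A = insert x C \<and> B = C"
    by (simp add: doubleton_eq_iff)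
  then show "(\<exists>x\<in>verts G - A. B = insert x A) \<or> (\<exists>x\<in>A. B = A - {x})"
  proof
    assume "A = insert x C \<and> B = C"
    then have "x \<in> A" "B = A - {x}"
      using C(2) by auto
    then show ?thesis
      by blast
  qed (use C(2) in blast)
next
  assume "(\<exists>x\<in>verts G - A. B = insert x A) \<or> (\<exists>x\<in>A. B = A - {x})"
  then show "adjacent (dominating_graph k G) A B"
    using A B unfolding adjacent_def dominating_graph_def Let_def by simp blast
qed

lemma degree_dominating_graph:
  assumes G: "simple_graph G" and D: "dominating_set G D" "card D \<le> k"
  shows "degree (dominating_graph k G) D =
    (if card D < k then card (verts G) - card D else 0) +
    card {x \<in> D. dominating_set G (D - {x})}"
proof -
  let ?H = "dominating_graph k G"
  let ?U = "{x \<in> verts G - D. card D < k}" and ?L = "{x \<in> D. dominating_set G (D - {x})}"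
  have fin: "finite D" "finite (verts G)" and sub: "D \<subseteq> verts G"
    using G D finite_dominating_set by (auto simp: simple_graph_def dominating_set_def)
  have DH: "D \<in> verts ?H"
    using D by (simp add: verts_dominating_graph)
  have up: "insert x D \<in> verts ?H \<longleftrightarrow> card D < k" if "x \<in> verts G - D" for x
    using that sub fin D dominating_set_mono[OF D(1), of "insert x D"]
    by (auto simp: verts_dominating_graph)
  have down: "D - {x} \<in> verts ?H \<longleftrightarrow> dominating_set G (D - {x})" if "x \<in> D" for x
    using that fin D card_Diff1_le[of D x] by (auto simp: verts_dominating_graph)
  have "B \<in> verts ?H \<and> adjacent ?H D B \<longleftrightarrow>
      B \<in> (\<lambda>x. insert x D) ` ?U \<union> (\<lambda>x. D - {x}) ` ?L" for B
  proof
    assume "B \<in> verts ?H \<and> adjacent ?H D B"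
    then have "B \<in> verts ?H" "(\<exists>x\<in>verts G - D. B = insert x D) \<or> (\<exists>x\<in>D. B = D - {x})"
      using adjacent_dominating_graph[OF DH] by blast+
    then show "B \<in> (\<lambda>x. insert x D) ` ?U \<union> (\<lambda>x. D - {x}) ` ?L"
      using up down by (elim disjE bexE) auto
  next
    assume "B \<in> (\<lambda>x. insert x D) ` ?U \<union> (\<lambda>x. D - {x}) ` ?L"
    then have B: "(\<exists>x\<in>verts G - D. B = insert x D \<and> card D < k) \<or>
        (\<exists>x\<in>D. B = D - {x} \<and> dominating_set G (D - {x}))"
      by blast
    then have "B \<in> verts ?H"
      using up down by (elim disjE bexE) simp_all
    then show "B \<in> verts ?H \<and> adjacent ?H D B"
      using B adjacent_dominating_graph[OF DH] by blast
  qed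
  then have "{B \<in> verts ?H. adjacent ?H D B} =
      (\<lambda>x. insert x D) ` ?U \<union> (\<lambda>x. D - {x}) ` ?L"
    by (simp add: set_eq_iff)
  moreover have "card ((\<lambda>x. insert x D) ` ?U \<union> (\<lambda>x. D - {x}) ` ?L) = card ?U + card ?L"
  proof (subst card_Un_disjoint)
    show "(\<lambda>x. insert x D) ` ?U \<inter> (\<lambda>x. D - {x}) ` ?L = {}"
      by blast
    have "inj_on (\<lambda>x. insert x D) ?U" "inj_on (\<lambda>x. D - {x}) ?L"
      by (auto simp: inj_on_def)
    then show "card ((\<lambda>x. insert x D) ` ?U) + card ((\<lambda>x. D - {x}) ` ?L) = card ?U + card ?L"
      by (simp add: card_image)
  qed (use fin in auto)
  moreover have "card ?U = (if card D < k then card (verts G) - card D else 0)"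
    using card_Diff_subset[OF fin(1) sub] by (simp add: set_diff_eq)
  ultimately show ?thesis
    by (simp add: degree_def)
qed

lemma eulerian_even_degree:
  assumes "eulerian (dominating_graph k G)" "dominating_set G D" "card D \<le> k"
  shows "even (degree (dominating_graph k G) D)"
  using assms by (simp add: eulerian_def verts_dominating_graph)

definition independent_set :: "'a graph \<Rightarrow> 'a set \<Rightarrow> bool" where
  "independent_set G I \<longleftrightarrow> (\<forall>u\<in>I. \<forall>v\<in>I. \<not> adjacent G u v)"

text \<open>A deleted \<open>x\<close> has no neighbour in \<open>I\<close>, so \<open>x\<close>
  itself is left undominated.\<close>

lemma independent_dominating_set_minimal:
  assumes "independent_set G I" "dominating_set G I"
  shows "{x \<in> I. dominating_set G (I - {x})} = {}"
  using assms unfolding independent_set_def dominating_set_def by fast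

lemma eulerian_even_independent_dominating_set:
  assumes "simple_graph G" "eulerian (dominating_graph k G)"
    and "independent_set G I" "dominating_set G I" "card I < k"
  shows "even (card (verts G) - card I)"
  using eulerian_even_degree[OF assms(2,4)] degree_dominating_graph[OF assms(1,4)] assms(5)
    independent_dominating_set_minimal[OF assms(3,4)] by simp

text \<open>
  If \<open>card I + 1 = k\<close> then \<open>insert a I\<close> has degree one; otherwise \<open>I\<close> and \<open>J\<close> have degrees of
  different parity.
\<close>

lemma not_eulerian_dominating_graphI:
  assumes G: "simple_graph G"
    and I: "independent_set G I" "dominating_set G I" "card I < k"
    and J: "independent_set G J" "dominating_set G J" "card J = Suc (card I)"
    and a: "a \<in> verts G - I" "\<And>x. x \<in> I \<Longrightarrow> \<not> dominating_set G (insert a I - {x})"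
  shows "\<not> eulerian (dominating_graph k G)"
proof
  assume E: "eulerian (dominating_graph k G)"
  have fin: "finite I" "finite (verts G)"
    using finite_dominating_set[OF G I(2)] G by (auto simp: simple_graph_def)
  show False
  proof (cases "Suc (card I) = k")
    case True
    have "dominating_set G (insert a I)"
      by (rule dominating_set_mono[OF I(2)]) (use a I(2) in \<open>auto simp: dominating_set_def\<close>)
    moreover have "card (insert a I) = k"
      using a True fin by simp
    moreover have "{x \<in> insert a I. dominating_set G (insert a I - {x})} = {a}"
      using a I(2) by auto
    ultimately show False
      using eulerian_even_degree[OF E, of "insert a I"]
        degree_dominating_graph[OF G, of "insert a I" k] by simp
  next
    case False
    have "card J \<le> card (verts G)"
      using J(2) fin by (auto simp: dominating_set_def intro: card_mono)
    moreover have "even (card (verts G) - card I)" "even (card (verts G) - card J)"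
      using eulerian_even_independent_dominating_set[OF G E I]
        eulerian_even_independent_dominating_set[OF G E J(1,2)] I(3) J(3) False by auto
    ultimately show False
      using J(3) by auto
  qed
qed

section \<open>Connectivity of the dominating graph\<close>

text \<open>Vertices outside \<open>A\<close> are removed one at a time. Every set on the way
  contains \<open>A\<close>, hence dominates, and lies in \<open>B\<close>, hence respects the bound
  \<open>k\<close>.\<close>

lemma reachable_superset:
  assumes "simple_graph G" "dominating_set G A" "A \<subseteq> B" "dominating_set G B" "card B \<le> k"
  shows "(A, B) \<in> connection (dominating_graph k G)"
proof -
  have fin: "finite B"
    using assms finite_dominating_set by blast
  have sub: "B \<subseteq> verts G"
    using assms by (simp add: dominating_set_def)
  have mem: "C \<in> verts (dominating_graph k G)" if "A \<subseteq> C" "C \<subseteq> B" for C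
    using that assms sub fin dominating_set_mono[OF assms(2), of C] card_mono[OF fin that(2)]
    by (auto simp: verts_dominating_graph)
  have "A \<subseteq> C \<longrightarrow> C \<subseteq> B \<longrightarrow> (adjacent (dominating_graph k G))\<^sup>*\<^sup>* A C" if "finite C" for C
    using that
  proof (induction rule: finite_psubset_induct)
    case (psubset C)
    show ?case
    proof (intro impI)
      assume C: "A \<subseteq> C" "C \<subseteq> B"
      show "(adjacent (dominating_graph k G))\<^sup>*\<^sup>* A C"
      proof (cases "A = C")
        case False
        then obtain x where x: "x \<in> C" "x \<notin> A"
          using C by blast
        then have "(adjacent (dominating_graph k G))\<^sup>*\<^sup>* A (C - {x})"
          using psubset C by blast
        moreover have "adjacent (dominating_graph k G) (C - {x}) C"
          using C x mem[of C] mem[of "C - {x}"] sub by (subst adjacent_dominating_graph) auto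
        ultimately show ?thesis
          by simp
      qed simp
    qed
  qed
  then show ?thesis
    using assms mem[of A] mem[of B] fin by (auto simp: connection_def)
qed

text \<open>Climb from \<open>A\<close> to the union, then descend to \<open>B\<close>.\<close>

lemma reachable_union:
  assumes "simple_graph G" "dominating_set G A" "dominating_set G B" "card (A \<union> B) \<le> k"
  shows "(A, B) \<in> connection (dominating_graph k G)"
proof -
  have AB: "dominating_set G (A \<union> B)"
    using assms dominating_set_mono[of G A "A \<union> B"] by (auto simp: dominating_set_def)
  have "(A, A \<union> B) \<in> connection (dominating_graph k G)"
    "(B, A \<union> B) \<in> connection (dominating_graph k G)"
    using reachable_superset[OF assms(1) _ _ AB assms(4)] assms by auto
  then show ?thesis
    using equiv_connection[of "dominating_graph k G"]
    by (meson equivE symD transD)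
qed

lemma reachable_chain:
  assumes "simple_graph G" "\<And>A. A \<in> set (R # As) \<Longrightarrow> dominating_set G A \<and> card A \<le> k"
    and "successively (\<lambda>A B. card (A \<union> B) \<le> k) (R # As)"
    and "A \<in> set (R # As)"
  shows "(R, A) \<in> connection (dominating_graph k G)"
  using assms(2-)
proof (induction As arbitrary: R)
  case Nil
  then show ?case
    by (auto simp: connection_def verts_dominating_graph)
next
  case (Cons B As)
  have "(R, R) \<in> connection (dominating_graph k G)"
    using Cons.prems(1) by (auto simp: connection_def verts_dominating_graph)
  moreover have "(R, B) \<in> connection (dominating_graph k G)"
    using Cons.prems reachable_union[OF assms(1)] by simp
  moreover have "(B, A) \<in> connection (dominating_graph k G)" if "A \<in> set (B # As)"
    using Cons.IH[of B] Cons.prems that by simp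
  ultimately show ?case
    using Cons.prems(3) equiv_connection[of "dominating_graph k G"]
    by (metis equivE set_ConsD transD)
qed

text \<open>
  The smaller end of every edge has fewer than \<open>k\<close> elements, so it suffices to connect those sets.
\<close>

lemma eulerian_dominating_graphI:
  assumes G: "simple_graph G"
    and even: "\<And>D. dominating_set G D \<Longrightarrow> card D \<le> k \<Longrightarrow>
      even (degree (dominating_graph k G) D)"
    and small: "\<And>D. dominating_set G D \<Longrightarrow> card D < k \<Longrightarrow> D \<in> set (R # As)"
    and As: "\<And>A. A \<in> set (R # As) \<Longrightarrow> dominating_set G A \<and> card A \<le> k"
      "successively (\<lambda>A B. card (A \<union> B) \<le> k) (R # As)"
  shows "eulerian (dominating_graph k G)"
proof -
  let ?H = "dominating_graph k G"
  have "C = connection ?H `` {R}" if nontrivial: "nontrivial_component ?H C" for C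
  proof -
    obtain e where C: "C \<in> verts ?H // connection ?H" and e: "e \<in> edges ?H" "e \<subseteq> C"
      using nontrivial unfolding nontrivial_component_def components_def by blast
    obtain A x where A: "e = {A, insert x A}" "x \<in> verts G - A" "A \<in> verts ?H"
        "insert x A \<in> verts ?H"
      using e(1) by (rule edges_dominating_graphE)
    have "finite A"
      using A(3) G finite_dominating_set by (auto simp: verts_dominating_graph)
    then have "card A < k"
      using A(2,4) by (simp add: verts_dominating_graph)
    then have D: "A \<in> e" "A \<in> set (R # As)"
      using A(1,3) small by (auto simp: verts_dominating_graph)
    then have "(R, A) \<in> connection ?H"
      using reachable_chain[OF G As] by blast
    moreover obtain B where B: "C = connection ?H `` {B}"
      using C by (rule quotientE)
    moreover have "(B, A) \<in> connection ?H"
      using B D(1) e(2) by blast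
    ultimately show ?thesis
      using equiv_connection[of ?H] by (metis equiv_class_eq)
  qed
  then show ?thesis
    using even by (auto simp: eulerian_def verts_dominating_graph)
qed

section \<open>Paths and cycles of general length\<close>

lemma verts_path_graph [simp]: "verts (path_graph n) = {..<n}"
  by (simp add: path_graph_def)

lemma verts_cycle_graph [simp]: "verts (cycle_graph n) = {..<n}"
  by (simp add: cycle_graph_def)

lemma adjacent_path_graph:
  "adjacent (path_graph n) u v \<longleftrightarrow> u < n \<and> v < n \<and> (v = u + 1 \<or> u = v + 1)"
  by (auto simp: adjacent_def path_graph_def doubleton_eq_iff)

lemma adjacent_cycle_graph:
  "adjacent (cycle_graph n) u v \<longleftrightarrow> u < n \<and> v = (u + 1) mod n \<or> v < n \<and> u = (v + 1) mod n"
  by (auto simp: adjacent_def cycle_graph_def doubleton_eq_iff)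

lemma card_residue_class:
  fixes a b c d :: nat
  assumes "c < d"
  shows "card {x. d * a \<le> x \<and> x < d * b \<and> x mod d = c} = b - a"
proof -
  have "x \<in> (\<lambda>j. d * j + c) ` {a..<b}" if x: "d * a \<le> x" "x < d * b" "x mod d = c" for x
  proof (rule image_eqI)
    show "x = d * (x div d) + c"
      using x(3) mult_div_mod_eq[of d x] by simp
    show "x div d \<in> {a..<b}"
      using x(1,2) assms
      by (simp add: less_eq_div_iff_mult_less_eq div_less_iff_less_mult mult.commute)
  qed
  moreover have "d * j + c < d * b" if "j < b" for j
    using that assms mult_le_mono2[of "Suc j" b d] by simp
  ultimately have "{x. d * a \<le> x \<and> x < d * b \<and> x mod d = c} = (\<lambda>j. d * j + c) ` {a..<b}"
    using assms by (auto simp: trans_le_add1)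
  moreover have "inj_on (\<lambda>j. d * j + c) {a..<b}"
    using assms by (auto simp: inj_on_def)
  ultimately show ?thesis
    by (simp add: card_image)
qed

text \<open>One of three consecutive numbers has residue \<open>c\<close>. At \<open>x = 0\<close>
  only 0 and 1 are available, which is why residue 2 requires \<open>0 < x\<close>.\<close>

lemma mod_3_cases:
  fixes c x :: nat
  assumes "c = 1 \<or> c = 2 \<and> 0 < x"
  shows "x mod 3 = c \<or> (x + 1) mod 3 = c \<or> 0 < x \<and> (x - 1) mod 3 = c"
  using assms by (cases x) (auto simp: mod_Suc)

lemma adjacent_commute: "adjacent G u v \<longleftrightarrow> adjacent G v u"
  by (simp add: adjacent_def insert_commute)

text \<open>
  The path and the cycle are treated together; \<open>w\<close> tells whether \<open>n - 1\<close> and \<open>0\<close> may be adjacent.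
\<close>

locale path_or_cycle =
  fixes G :: "nat graph" and n :: nat and w :: bool
  assumes n: "3 \<le> n"
    and simple: "simple_graph G"
    and verts: "verts G = {..<n}"
    and adjacent_Suc: "i + 1 < n \<Longrightarrow> adjacent G i (i + 1)"
    and adjacentD: "adjacent G u v \<Longrightarrow>
      v = u + 1 \<or> u = v + 1 \<or> w \<and> (u = 0 \<and> v + 1 = n \<or> v = 0 \<and> u + 1 = n)"
begin

text \<open>Only edges between consecutive numbers are used, so the criterion serves path and cycle
  alike.\<close>

lemma dominating_setI:
  assumes "D \<subseteq> {..<n}" "\<And>x. x < n \<Longrightarrow> x \<in> D \<or> x + 1 \<in> D \<or> (0 < x \<and> x - 1 \<in> D)"
  shows "dominating_set G D"
  unfolding dominating_set_def verts
proof (intro conjI ballI)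
  fix x
  assume x: "x \<in> {..<n} - D"
  then consider "x + 1 \<in> D" | "0 < x" "x - 1 \<in> D"
    using assms(2) by auto
  then show "\<exists>u\<in>D. adjacent G x u"
  proof cases
    case 1
    then show ?thesis
      using adjacent_Suc[of x] assms(1) by auto
  next
    case 2
    then show ?thesis
      using adjacent_Suc[of "x - 1"] x by (auto simp: adjacent_commute)
  qed
qed (fact assms(1))

text \<open>
  Splitting \<open>1\<close> into its two neighbours makes \<open>I\<close> into a larger independent dominating set.
  On the other hand, only \<open>0\<close> is superfluous in \<open>insert 0 I\<close>: the vertex \<open>2\<close> is dominated by
  \<open>1\<close> alone, and every other element of \<open>I\<close> has no neighbour in \<open>insert 0 I\<close>.
\<close>

lemma not_eulerianI:
  assumes I: "independent_set G I" "dominating_set G I" "card I < k"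
    and "1 \<in> I" "3 \<notin> I" "w \<Longrightarrow> n \<noteq> 3 \<and> n - 1 \<notin> I"
  shows "\<not> eulerian (dominating_graph k G)"
proof -
  have I_sub: "I \<subseteq> {..<n}" and fin: "finite I"
    using I(2) verts finite_dominating_set[OF simple I(2)] by (auto simp: dominating_set_def)
  have no: "\<not> adjacent G u v" if "u \<in> I" "v \<in> I" for u v
    using I(1) that by (simp add: independent_set_def)
  have "0 \<notin> I" "2 \<notin> I"
    using no[of 0 1] no[of 1 2] adjacent_Suc[of 0] adjacent_Suc[of 1] \<open>1 \<in> I\<close> n
    by (auto simp: numeral_2_eq_2)
  define J where "J = insert 0 (insert 2 (I - {1}))"
  \<comment> \<open>The possible neighbours of 0 are 1, which was removed, and on a cycle
    \<open>n - 1\<close>, which is not in \<open>I\<close> and differs from 2 as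
    \<open>n \<noteq> 3\<close>. Those of 2 are 1 and 3, and \<open>3 \<notin> I\<close>.\<close>
  have J_adj: "\<not> adjacent G 0 v" "\<not> adjacent G 2 v" if "v \<in> J" for v
    using adjacentD[of 0 v] adjacentD[of 2 v] that assms(4-) n \<open>0 \<notin> I\<close> \<open>2 \<notin> I\<close>
    by (auto simp: J_def)
  have "independent_set G J"
    unfolding independent_set_def
  proof (intro ballI)
    fix u v
    assume "u \<in> J" "v \<in> J"
    then show "\<not> adjacent G u v"
      using J_adj[of u] J_adj[of v] no[of u v] adjacent_commute[of G u v] by (auto simp: J_def)
  qed
  moreover have "dominating_set G J"
    unfolding dominating_set_def
  proof (intro conjI ballI)
    fix x
    assume x: "x \<in> verts G - J"
    show "\<exists>u\<in>J. adjacent G x u"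
    proof (cases "x = 1")
      case True
      then show ?thesis
        using adjacent_Suc[of 0] adjacent_commute[of G 0 1] n by (auto simp: J_def)
    next
      case False
      then obtain u where u: "u \<in> I" "adjacent G x u"
        using x I(2) by (auto simp: J_def dominating_set_def)
      \<comment> \<open>All neighbours of 1 lie in \<open>J\<close>, so a vertex outside
        \<open>J\<close> other than 1 keeps its dominating vertex from \<open>I\<close>.\<close>
      then have "u \<noteq> 1"
        using adjacentD[of x 1] x assms(6) n by (auto simp: J_def)
      then show ?thesis
        using u by (auto simp: J_def)
    qed
  qed (use I_sub n verts in \<open>auto simp: J_def\<close>)
  moreover have "card J = Suc (card I)"
    using fin \<open>1 \<in> I\<close> \<open>0 \<notin> I\<close> \<open>2 \<notin> I\<close> card_Suc_Diff1[of I 1] by (simp add: J_def)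
  moreover have "\<not> dominating_set G (insert 0 I - {x})" if "x \<in> I" for x
  proof -
    \<comment> \<open>\<open>p\<close> is a vertex that loses its domination when \<open>x\<close>
      is deleted. For \<open>x = 1\<close> it cannot be 1 itself, which 0 now dominates.\<close>
    define p where "p = (if x = 1 then 2 else x)"
    have "p \<in> verts G - (insert 0 I - {x})"
      using that I_sub n verts \<open>0 \<notin> I\<close> \<open>2 \<notin> I\<close> by (auto simp: p_def)
    moreover have "\<not> adjacent G p u" if "u \<in> insert 0 I - {x}" for u
      using that \<open>x \<in> I\<close> no[of x u] adjacentD[of p u] assms(4-) n I_sub by (auto simp: p_def)
    ultimately show ?thesis
      unfolding dominating_set_def by blast
  qed
  ultimately show ?thesis
    using not_eulerian_dominating_graphI[OF simple I, of J 0] verts n \<open>0 \<notin> I\<close> by auto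
qed

text \<open>Excluding 0 disposes of the wrap-around edge of the cycle.\<close>

lemma independent_setI:
  assumes "\<And>x. x \<in> I \<Longrightarrow> x + 1 \<notin> I" "0 \<notin> I"
  shows "independent_set G I"
  using assms adjacentD by (auto simp: independent_set_def)

lemma not_eulerian:
  assumes "n \<noteq> 4" "w \<Longrightarrow> n \<noteq> 3 \<and> n \<noteq> 7" "n + 3 \<le> 3 * k"
  shows "\<not> eulerian (dominating_graph k G)"
proof -
  define m where "m = n div 3"
  consider "n = 3 * m" | "n = 3 * m + 1" | "n = 3 * m + 2"
    unfolding m_def by linarith
  then show ?thesis
  proof cases
    case 1
    \<comment> \<open>The middle vertices of the \<open>m\<close> consecutive triples.\<close>
    define I where "I = {x. x < 3 * m \<and> x mod 3 = 1}"
    have "card I = m"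
      using card_residue_class[of 1 3 0 m] by (simp add: I_def)
    then have "card I < k"
      using assms(3) 1 by simp
    moreover have "independent_set G I"
      by (rule independent_setI) (auto simp: I_def mod_Suc)
    moreover have "dominating_set G I"
    proof (rule dominating_setI)
      fix x
      assume x: "x < n"
      have "x + 1 < n" if "(x + 1) mod 3 = 1"
        using that x 1 by (cases "x + 1 = n") auto
      then show "x \<in> I \<or> x + 1 \<in> I \<or> (0 < x \<and> x - 1 \<in> I)"
        using mod_3_cases[of 1 x] x 1 by (auto simp: I_def)
    qed (use 1 in \<open>auto simp: I_def\<close>)
    moreover have "1 \<in> I" "3 \<notin> I"
      using n 1 by (auto simp: I_def)
    moreover have "n - 1 \<notin> I"
      using n 1 mod_Suc[of "n - 1" 3] by (auto simp: I_def)
    ultimately show ?thesis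
      using assms(2) not_eulerianI by blast
  next
    case 2
    have "2 \<le> m"
      using 2 n assms(1) by presburger
    define B where "B = {x. 3 * 2 \<le> x \<and> x < 3 * m \<and> x mod 3 = 2}"
    \<comment> \<open>One vertex more than \<open>m\<close> triples: 1 and 4 cover 0 to 5, 6 covers
      up to 7, and 8, 11, ..., \<open>3 * m - 1\<close> cover the rest. The shift to residue 2 keeps
      \<open>n - 1\<close> out of \<open>I\<close>, except for \<open>n = 7\<close>, where
      \<open>B\<close> is empty and \<open>n - 1 = 6\<close>.\<close>
    define I where "I = {1, 4, 6} \<union> B"
    have I: "x \<in> I \<longleftrightarrow> x = 1 \<or> x = 4 \<or> x = 6 \<or> 6 \<le> x \<and> x < 3 * m \<and> x mod 3 = 2" for x
      by (auto simp: I_def B_def)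
    have "card I = 3 + card B"
      unfolding I_def by (subst card_Un_disjoint) (auto simp: B_def)
    then have "card I < k"
      using card_residue_class[of 2 3 2 m] assms(3) 2 \<open>2 \<le> m\<close> by (simp add: B_def)
    moreover have "independent_set G I"
      by (rule independent_setI) (auto simp: I mod_Suc)
    moreover have "dominating_set G I"
    proof (rule dominating_setI)
      fix x
      assume x: "x < n"
      show "x \<in> I \<or> x + 1 \<in> I \<or> (0 < x \<and> x - 1 \<in> I)"
      proof (cases "x < 7")
        case True
        then have "x \<in> {0, 1, 2, 3, 4, 5, 6}"
          by auto
        then show ?thesis
          by (auto simp: I)
      next
        case False
        \<comment> \<open>Applied to \<open>x + 1\<close>, this ensures that a dominating vertex of
          residue 2 does not fall off the end.\<close>
        have "y < 3 * m" if "y \<le> n" "y mod 3 = 2" for y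
        proof (rule ccontr)
          assume "\<not> y < 3 * m"
          then have "y = 3 * m \<or> y = 3 * m + 1"
            using that 2 by auto
          then show False
            using that(2) by auto
        qed
        then show ?thesis
          using mod_3_cases[of 2 x] x False by (auto simp: I)
      qed
    qed (use 2 \<open>2 \<le> m\<close> in \<open>auto simp: I\<close>)
    moreover have "1 \<in> I" "3 \<notin> I"
      by (simp_all add: I)
    moreover have "n \<noteq> 7 \<Longrightarrow> n - 1 \<notin> I"
      using 2 \<open>2 \<le> m\<close> by (auto simp: I)
    ultimately show ?thesis
      using assms(2) not_eulerianI by blast
  next
    case 3
    \<comment> \<open>No second set is needed here: \<open>n - card I = 2 * m + 1\<close> is odd.
      The last element of \<open>I\<close> is \<open>n - 1\<close>.\<close>
    define I where "I = {x. x < 3 * (m + 1) \<and> x mod 3 = 1}"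
    have "card I = m + 1"
      using card_residue_class[of 1 3 0 "m + 1"] by (simp add: I_def)
    moreover have "independent_set G I"
      by (rule independent_setI) (auto simp: I_def mod_Suc)
    moreover have "dominating_set G I"
    proof (rule dominating_setI)
      show "I \<subseteq> {..<n}"
      proof
        fix x
        assume "x \<in> I"
        then have "x < n \<or> x = n" "x mod 3 = 1"
          using 3 by (auto simp: I_def)
        moreover have "n mod 3 = 2"
          using 3 by presburger
        ultimately show "x \<in> {..<n}"
          by auto
      qed
      fix x
      assume "x < n"
      then show "x \<in> I \<or> x + 1 \<in> I \<or> (0 < x \<and> x - 1 \<in> I)"
        using mod_3_cases[of 1 x] 3 by (auto simp: I_def)
    qed
    ultimately show ?thesis
      using eulerian_even_independent_dominating_set[OF simple, of k I] verts 3 assms(3) by auto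
  qed
qed

end

lemma path_or_cycle_path_graph:
  assumes "3 \<le> n"
  shows "path_or_cycle (path_graph n) n False"
  by unfold_locales (use assms simple_graph_path_graph in \<open>auto simp: adjacent_path_graph\<close>)

lemma path_or_cycle_cycle_graph:
  assumes "3 \<le> n"
  shows "path_or_cycle (cycle_graph n) n True"
proof unfold_locales
  show "adjacent (cycle_graph n) i (i + 1)" if "i + 1 < n" for i
    using that by (simp add: adjacent_cycle_graph)
  have wrap: "j = i + 1 \<or> j = 0 \<and> i + 1 = n" if "i < n" "j = (i + 1) mod n" for i j
    using that by (cases "i + 1 = n") auto
  show "v = u + 1 \<or> u = v + 1 \<or> True \<and> (u = 0 \<and> v + 1 = n \<or> v = 0 \<and> u + 1 = n)"
    if "adjacent (cycle_graph n) u v" for u v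
  proof -
    have "u < n \<and> v = (u + 1) mod n \<or> v < n \<and> u = (v + 1) mod n"
      using that by (simp only: adjacent_cycle_graph)
    then show ?thesis
      using wrap[of u v] wrap[of v u] by argo
  qed
qed (use assms simple_graph_cycle_graph in simp_all)

section \<open>Small cases by evaluation\<close>

text \<open>Lists and a decidable relation \<open>r\<close> replace sets and edge sets, so that
  \<open>code_simp\<close> can evaluate the test.\<close>

definition dominates :: "(nat \<Rightarrow> nat \<Rightarrow> bool) \<Rightarrow> nat \<Rightarrow> nat list \<Rightarrow> bool" where
  "dominates r n xs \<longleftrightarrow> list_all (\<lambda>v. list_ex (\<lambda>u. u = v \<or> r v u) xs) [0..<n]"

text \<open>Mirrors the formula of \<open>degree_dominating_graph\<close>; it is meant for distinct
  lists.\<close>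

definition list_degree :: "(nat \<Rightarrow> nat \<Rightarrow> bool) \<Rightarrow> nat \<Rightarrow> nat \<Rightarrow> nat list \<Rightarrow> nat" where
  "list_degree r n k xs = (if length xs < k then n - length xs else 0) +
     length (filter (\<lambda>x. dominates r n (removeAll x xs)) xs)"

lemma dominating_set_iff_dominates:
  assumes "verts G = {..<n}" "\<And>u v. u < n \<Longrightarrow> v < n \<Longrightarrow> adjacent G u v \<longleftrightarrow> r u v"
    and "set xs \<subseteq> {..<n}"
  shows "dominating_set G (set xs) \<longleftrightarrow> dominates r n xs"
  using assms by (fastforce simp: dominating_set_def dominates_def list_all_iff list_ex_iff)

lemma degree_eq_list_degree:
  assumes "simple_graph G" "verts G = {..<n}"
    and r: "\<And>u v. u < n \<Longrightarrow> v < n \<Longrightarrow> adjacent G u v \<longleftrightarrow> r u v"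
    and xs: "set xs \<subseteq> {..<n}" "distinct xs" "dominates r n xs" "length xs \<le> k"
  shows "degree (dominating_graph k G) (set xs) = list_degree r n k xs"
proof -
  note dom = dominating_set_iff_dominates[OF assms(2) r]
  have "{x \<in> set xs. dominating_set G (set xs - {x})} =
      set (filter (\<lambda>x. dominates r n (removeAll x xs)) xs)"
    using dom[of "removeAll _ xs"] xs(1) by auto
  then show ?thesis
    using degree_dominating_graph[OF assms(1), of "set xs" k] dom[OF _ _ xs(1)] xs assms(2)
    by (simp add: list_degree_def distinct_card del: set_filter)
qed

text \<open>The sublists of \<open>[0..<n]\<close> represent all vertex sets, so the parity check is
  finite; the list \<open>ys # yss\<close> is a certificate of connectivity.\<close>

lemma eulerian_by_enumeration:
  assumes G: "simple_graph G" "verts G = {..<n}"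
    and r: "\<And>u v. u < n \<Longrightarrow> v < n \<Longrightarrow> adjacent G u v \<longleftrightarrow> r u v"
    and all: "\<forall>xs\<in>set (subseqs [0..<n]). dominates r n xs \<longrightarrow>
      (length xs \<le> k \<longrightarrow> even (list_degree r n k xs)) \<and>
      (length xs < k \<longrightarrow> xs \<in> set (ys # yss))"
    and chain: "\<forall>xs\<in>set (ys # yss).
        (\<forall>x\<in>set xs. x < n) \<and> dominates r n xs \<and> length xs \<le> k"
      "successively (\<lambda>xs xs'. length (remdups (xs @ xs')) \<le> k) (ys # yss)"
  shows "eulerian (dominating_graph k G)"
proof (rule eulerian_dominating_graphI[OF G(1), where R = "set ys" and As = "map set yss"])
  note dom = dominating_set_iff_dominates[OF G(2) r]
  have list: "\<exists>xs\<in>set (subseqs [0..<n]). D = set xs \<and> set xs \<subseteq> {..<n} \<and> distinct xs \<and>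
      dominates r n xs \<and> length xs = card D" if D: "dominating_set G D" for D
  proof -
    have sub: "D \<subseteq> {..<n}"
      using D G(2) by (simp add: dominating_set_def)
    then have "D \<in> set ` set (subseqs [0..<n])"
      by (simp add: subseqs_powset atLeast0LessThan)
    then obtain xs where xs: "xs \<in> set (subseqs [0..<n])" "D = set xs"
      by blast
    moreover have "distinct xs"
      using xs(1) by (rule subseqs_distinctD) simp
    ultimately show ?thesis
      using sub D dom[of xs] by (auto simp: distinct_card)
  qed
  show "even (degree (dominating_graph k G) D)" if D: "dominating_set G D" "card D \<le> k" for D
  proof -
    obtain xs where "xs \<in> set (subseqs [0..<n])" "D = set xs" "set xs \<subseteq> {..<n}" "distinct xs"
        "dominates r n xs" "length xs = card D"
      using list[OF D(1)] by blast
    then show ?thesis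
      using all D(2) degree_eq_list_degree[OF G r, of xs k] by simp
  qed
  show "D \<in> set (set ys # map set yss)" if D: "dominating_set G D" "card D < k" for D
  proof -
    obtain xs where "xs \<in> set (subseqs [0..<n])" "D = set xs" "dominates r n xs"
        "length xs = card D"
      using list[OF D(1)] by blast
    then show ?thesis
      using all D(2) by fastforce
  qed
  show "dominating_set G A \<and> card A \<le> k" if A: "A \<in> set (set ys # map set yss)" for A
  proof -
    obtain xs where xs: "A = set xs" "xs \<in> set (ys # yss)"
      using A by auto
    then have "set xs \<subseteq> {..<n}" "dominates r n xs" "length xs \<le> k"
      using chain(1) by auto
    then show ?thesis
      using xs(1) dom[of xs] card_length[of xs] by simp
  qed
  have "successively (\<lambda>A B. card (A \<union> B) \<le> k) (map set (ys # yss))"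
    using chain(2) by (simp only: successively_map length_remdups_card_conv set_append)
  then show "successively (\<lambda>A B. card (A \<union> B) \<le> k) (set ys # map set yss)"
    by simp
qed

lemma adjacent_path_graph_lessThan:
  "u < n \<Longrightarrow> v < n \<Longrightarrow> adjacent (path_graph n) u v \<longleftrightarrow> v = u + 1 \<or> u = v + 1"
  by (simp add: adjacent_path_graph)

lemma adjacent_cycle_graph_lessThan:
  "u < n \<Longrightarrow> v < n \<Longrightarrow>
    adjacent (cycle_graph n) u v \<longleftrightarrow> v = (u + 1) mod n \<or> u = (v + 1) mod n"
  by (simp add: adjacent_cycle_graph)

lemma eulerian_path_4_3: "eulerian (dominating_graph 3 (path_graph 4))"
proof (rule eulerian_by_enumeration[OF _ _ adjacent_path_graph_lessThan])
  \<comment> \<open>These are the four dominating 2-sets of the path; consecutive ones share a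
    vertex.\<close>
  show "successively (\<lambda>xs xs'. length (remdups (xs @ xs')) \<le> 3)
      ([0, 2] # [[0, 3], [1, 3], [1, 2]] :: nat list list)"
    by code_simp
qed (simp add: simple_graph_path_graph, simp, assumption, assumption, code_simp+)

lemma eulerian_cycle_3_2: "eulerian (dominating_graph 2 (cycle_graph 3))"
proof (rule eulerian_by_enumeration[OF _ _ adjacent_cycle_graph_lessThan])
  show "successively (\<lambda>xs xs'. length (remdups (xs @ xs')) \<le> 2) ([0] # [[1], [2]] :: nat list list)"
    by code_simp
qed (simp add: simple_graph_cycle_graph, simp, assumption, assumption, code_simp+)

text \<open>
  The list alternates between the dominating 3-sets \<open>{i, i + 3, i + 5}\<close> and \<open>{i, i + 3, i + 6}\<close>
  modulo 7: replace \<open>i + 5\<close> by \<open>i + 6\<close>, then \<open>i\<close> by \<open>i + 1\<close>, which gives the first form for \<open>i + 3\<close>.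
\<close>

lemma eulerian_cycle_7_4: "eulerian (dominating_graph 4 (cycle_graph 7))"
proof (rule eulerian_by_enumeration[OF _ _ adjacent_cycle_graph_lessThan])
  show "successively (\<lambda>xs xs'. length (remdups (xs @ xs')) \<le> 4)
      ([0, 3, 5] # [[0, 3, 6], [1, 3, 6], [2, 3, 6], [2, 4, 6], [2, 5, 6], [0, 2, 5], [1, 2, 5],
        [1, 3, 5], [1, 4, 5], [1, 4, 6], [0, 1, 4], [0, 2, 4], [0, 3, 4]] :: nat list list)"
    by code_simp
qed (simp add: simple_graph_cycle_graph, simp, assumption, assumption, code_simp+)

lemma not_eulerian_by_list:
  assumes "simple_graph G" "verts G = {..<n}"
    and r: "\<And>u v. u < n \<Longrightarrow> v < n \<Longrightarrow> adjacent G u v \<longleftrightarrow> r u v"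
    and xs: "\<forall>x\<in>set xs. x < n" "distinct xs" "dominates r n xs" "length xs \<le> k"
      "odd (list_degree r n k xs)"
  shows "\<not> eulerian (dominating_graph k G)"
proof -
  have sub: "set xs \<subseteq> {..<n}"
    using xs(1) by auto
  then have "dominating_set G (set xs)" "card (set xs) \<le> k"
    using dominating_set_iff_dominates[OF assms(2) r] xs by (simp_all add: distinct_card)
  moreover have "odd (degree (dominating_graph k G) (set xs))"
    using degree_eq_list_degree[OF assms(1,2) r sub xs(2-4)] xs(5) by simp
  ultimately show ?thesis
    using eulerian_even_degree by blast
qed

lemma not_eulerian_cycle_4_3: "\<not> eulerian (dominating_graph 3 (cycle_graph 4))"
proof (rule not_eulerian_by_list[OF _ _ adjacent_cycle_graph_lessThan])
  show "distinct [0, 1, 2 :: nat]"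
    by code_simp
qed (simp add: simple_graph_cycle_graph, simp, assumption, assumption, code_simp+)

lemma not_eulerian_cycle_7:
  assumes "4 < k"
  shows "\<not> eulerian (dominating_graph k (cycle_graph 7))"
proof (rule not_eulerian_by_list[OF _ _ adjacent_cycle_graph_lessThan])
  let ?r = "\<lambda>u v. v = (u + 1) mod 7 \<or> u = (v + 1) mod (7::nat)"
  show "distinct [0, 2, 4, 6 :: nat]"
    by code_simp
  have "length (filter (\<lambda>x. dominates ?r 7 (removeAll x [0, 2, 4, 6])) [0, 2, 4, 6]) = 2"
    by code_simp
  then show "odd (list_degree ?r 7 k [0, 2, 4, 6])"
    using assms by (simp add: list_degree_def del: filter.simps removeAll.simps)
  show "dominates ?r 7 [0, 2, 4, 6]"
    by code_simp
qed (use assms in \<open>simp_all add: simple_graph_cycle_graph\<close>)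

theorem theorem8:
  fixes n k :: nat
  assumes "n \<ge> 3" and "\<lceil>real n / 3\<rceil> < int k" and "k < n"
  shows "(eulerian (dominating_graph k (path_graph n)) \<longleftrightarrow> n = 4 \<and> k = 3) \<and>
         (eulerian (dominating_graph k (cycle_graph n)) \<longleftrightarrow>
            (n = 7 \<and> k = 4) \<or> (n = 3 \<and> k = 2))"
proof -
  \<comment> \<open>A strict inequality between integers gains 1: the ceiling is at most
    \<open>k - 1\<close>.\<close>
  have "real n / 3 \<le> real k - 1"
    using assms(2) by linarith
  then have nk: "n + 3 \<le> 3 * k"
    by linarith
  have path: "\<not> eulerian (dominating_graph k (path_graph n))" if "n \<noteq> 4"
    using path_or_cycle.not_eulerian[OF path_or_cycle_path_graph] assms(1) nk that by blast
  have cycle: "\<not> eulerian (dominating_graph k (cycle_graph n))" if "n \<notin> {3, 4, 7}"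
    using path_or_cycle.not_eulerian[OF path_or_cycle_cycle_graph] assms(1) nk that by blast
  show ?thesis
  proof (cases "n \<in> {3, 4, 7}")
    case True
    \<comment> \<open>For \<open>n = 3\<close> and \<open>n = 4\<close> the bounds leave a single
      \<open>k\<close>.\<close>
    then have "n = 3 \<and> k = 2 \<or> n = 4 \<and> k = 3 \<or> n = 7 \<and> k = 4 \<or> n = 7 \<and> 4 < k"
      using assms(3) nk by auto
    then show ?thesis
      using path eulerian_path_4_3 eulerian_cycle_3_2 eulerian_cycle_7_4 not_eulerian_cycle_4_3
        not_eulerian_cycle_7 by auto
  qed (use path cycle in auto)
qed

end
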